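(* Let $(\mathbb{X},d)$ be a metric space with $|\mathbb{X}|\geq 3$. Suppose that every mapping $T:\mathbb{X}\to\mathbb{X}$ satisfying the following two conditions has a fixed point: (i) $T^2x\neq x$ for all $x\in\mathbb{X}$ with $Tx\neq x$; (ii) there exists $k\in(0,1)$ such that for every three pairwise distinct points $x,y,z\in\mathbb{X}$, $$d(Tx,Ty)+d(Ty,Tz)+d(Tz,Tx)\leq k\max\big\{d(x',y')+d(y',z')+d(z',x') : x',y',z'\in\{x,y,z,Tx,Ty,Tz\},\ x',y',z'\text{ pairwise distinct}\big\}.$$ Then $(\mathbb{X},d)$ is complete.
   Context: A fixed point of $T$ is a point $x\in\mathbb{X}$ with $Tx=x$; $T^2$ denotes $T\circ T$. *)

theory Defs
  imports "HOL-Analysis.Analysis"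
begin

definition perimeter :: "('a \<Rightarrow> 'a \<Rightarrow> real) \<Rightarrow> 'a \<Rightarrow> 'a \<Rightarrow> 'a \<Rightarrow> real" where
  "perimeter d x y z = d x y + d y z + d z x"

definition perimeters_on :: "('a \<Rightarrow> 'a \<Rightarrow> real) \<Rightarrow> 'a set \<Rightarrow> real set" where
  "perimeters_on d S =
     {perimeter d x y z | x y z. x \<in> S \<and> y \<in> S \<and> z \<in> S \<and> x \<noteq> y \<and> y \<noteq> z \<and> z \<noteq> x}"

definition no_two_cycles :: "'a set \<Rightarrow> ('a \<Rightarrow> 'a) \<Rightarrow> bool" where
  "no_two_cycles X T \<longleftrightarrow> (\<forall>x\<in>X. T x \<noteq> x \<longrightarrow> (T \<circ> T) x \<noteq> x)"

text \<open>
  The maximum is taken over a finite set that is nonempty because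
  it contains the perimeter of \<open>x\<close>, \<open>y\<close>, \<open>z\<close> themselves.
\<close>

definition perimeter_quasi_contraction ::
    "'a set \<Rightarrow> ('a \<Rightarrow> 'a \<Rightarrow> real) \<Rightarrow> ('a \<Rightarrow> 'a) \<Rightarrow> bool" where
  "perimeter_quasi_contraction X d T \<longleftrightarrow>
     (\<exists>k::real. 0 < k \<and> k < 1 \<and>
        (\<forall>x\<in>X. \<forall>y\<in>X. \<forall>z\<in>X. x \<noteq> y \<and> y \<noteq> z \<and> z \<noteq> x \<longrightarrow>
           perimeter d (T x) (T y) (T z)
             \<le> k * Max (perimeters_on d {x, y, z, T x, T y, T z})))"

end

theory Submission
  imports Defs
begin

text \<open>
  If a Cauchy sequence \<open>u\<close> has no limit, the distance to its ideal limit,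
  \<open>L x = lim d x (u n)\<close>, is positive on \<open>X\<close> but takes arbitrarily small values on \<open>u\<close>.
  Choose \<open>T x\<close> in \<open>X\<close> with \<open>L (T x) \<le> L x / 5\<close>. Then \<open>T\<close> strictly decreases \<open>L\<close>, so it has no
  fixed points and no 2-cycles. Perimeters of image triples are at most \<open>6/5\<close> times the largest
  of \<open>L x, L y, L z\<close>; if that is \<open>L x\<close>, then \<open>x\<close>, \<open>T x\<close> and one of \<open>y, z\<close> form a triple of
  perimeter at least \<open>2 d x (T x) \<ge> 8/5 * L x\<close>, so \<open>T\<close> is a contraction with \<open>k = 3/4\<close>.
\<close>

text \<open>By the triangle inequality \<open>d x (u m)\<close> and \<open>d x (u n)\<close> differ
  by at most \<open>d (u m) (u n)\<close>, so these distances form a Cauchy sequence of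
  reals.\<close>

lemma (in Metric_space) MCauchy_dist_limit:
  assumes "MCauchy u"
  obtains L where "\<And>x. x \<in> M \<Longrightarrow> (\<lambda>n. d x (u n)) \<longlonglongrightarrow> L x"
proof -
  have "convergent (\<lambda>n. d x (u n))" if "x \<in> M" for x
    unfolding Cauchy_convergent_iff[symmetric] Cauchy_def dist_real_def
  proof (intro allI impI)
    fix e :: real assume "e > 0"
    then obtain N where N: "\<And>n m. N \<le> n \<Longrightarrow> N \<le> m \<Longrightarrow> d (u n) (u m) < e"
      using assms unfolding MCauchy_def by meson
    have "\<bar>d x (u m) - d x (u n)\<bar> < e" if "m \<ge> N" "n \<ge> N" for m n
    proof -
      have "u m \<in> M" "u n \<in> M"
        using assms by (auto simp: MCauchy_def)
      with \<open>x \<in> M\<close> have "\<bar>d x (u m) - d x (u n)\<bar> \<le> d (u m) (u n)"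
        using triangle[of x "u m" "u n"] triangle[of x "u n" "u m"] commute[of "u m" "u n"]
        by linarith
      then show ?thesis using N that by fastforce
    qed
    then show "\<exists>N. \<forall>m\<ge>N. \<forall>n\<ge>N. \<bar>d x (u m) - d x (u n)\<bar> < e" by blast
  qed
  then show thesis
    using that[of "\<lambda>x. lim (\<lambda>n. d x (u n))"] by (simp add: convergent_LIMSEQ_iff)
qed

text \<open>\<open>L\<close> is the distance to a missing point of the completion: the two middle
  properties are triangle inequalities through that point, obtained as limits of those through
  \<open>u n\<close>. A zero of \<open>L\<close> would be a limit of \<open>u\<close>.\<close>

lemma (in Metric_space) not_mcomplete_ideal_dist:
  assumes "\<not> mcomplete"
  obtains L :: "'a \<Rightarrow> real" where
    "\<And>x. x \<in> M \<Longrightarrow> 0 < L x"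
    "\<And>x y. x \<in> M \<Longrightarrow> y \<in> M \<Longrightarrow> d x y \<le> L x + L y"
    "\<And>x y. x \<in> M \<Longrightarrow> y \<in> M \<Longrightarrow> L x \<le> d x y + L y"
    "\<And>e. 0 < e \<Longrightarrow> \<exists>x\<in>M. L x \<le> e"
proof -
  obtain u where u: "MCauchy u" and nolim: "\<And>x. \<not> limitin mtopology u x sequentially"
    using assms unfolding mcomplete_def by blast
  have uM: "u n \<in> M" for n using u by (auto simp: MCauchy_def)
  obtain L where L: "\<And>x. x \<in> M \<Longrightarrow> (\<lambda>n. d x (u n)) \<longlonglongrightarrow> L x"
    by (rule MCauchy_dist_limit[OF u]) blast
  show thesis
  proof (rule that[of L])
    fix x assume x: "x \<in> M"
    have "L x \<ge> 0" by (rule LIMSEQ_le_const[OF L[OF x]]) simp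
    moreover have "L x \<noteq> 0"
    proof
      assume "L x = 0"
      then have "(\<lambda>n. d (u n) x) \<longlonglongrightarrow> 0" using L[OF x] by (simp add: commute)
      then have "limitin mtopology u x sequentially"
        using x uM by (simp add: limitin_metric_dist_null)
      then show False using nolim by blast
    qed
    ultimately show "0 < L x" by simp
  next
    fix x y assume xy: "x \<in> M" "y \<in> M"
    have "d x y \<le> d x (u n) + d y (u n)" for n
      using triangle[of x "u n" y] xy uM by (simp add: commute)
    then show "d x y \<le> L x + L y"
      by (intro LIMSEQ_le_const[OF tendsto_add[OF L[OF xy(1)] L[OF xy(2)]]]) auto
    have "d x (u n) \<le> d x y + d y (u n)" for n
      using triangle[of x y "u n"] xy uM by simp
    then show "L x \<le> d x y + L y"
      by (intro LIMSEQ_le[OF L[OF xy(1)] tendsto_add[OF tendsto_const L[OF xy(2)]]]) auto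
  next
    fix e :: real assume "0 < e"
    then obtain N where N: "\<And>n m. N \<le> n \<Longrightarrow> N \<le> m \<Longrightarrow> d (u n) (u m) < e"
      using u unfolding MCauchy_def by meson
    \<comment> \<open>From \<open>N\<close> on, the terms \<open>d (u N) (u n)\<close> are below
      \<open>e\<close>; the limit keeps only the weak inequality.\<close>
    have "L (u N) \<le> e"
      by (rule LIMSEQ_le_const2[OF L[OF uM]]) (use N less_imp_le in blast)
    then show "\<exists>x\<in>M. L x \<le> e" using uM by blast
  qed
qed

lemma finite_perimeters_on:
  assumes "finite S"
  shows "finite (perimeters_on d S)"
proof -
  have "perimeters_on d S \<subseteq> (\<lambda>(x, y, z). perimeter d x y z) ` (S \<times> S \<times> S)"
    unfolding perimeters_on_def by (auto intro!: image_eqI[of _ _ "(_, _, _)"])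
  then show ?thesis using assms by (auto intro: finite_subset)
qed

lemma (in Metric_space) twice_dist_le_perimeter:
  assumes "x \<in> M" "y \<in> M" "z \<in> M"
  shows "2 * d x y \<le> perimeter d x y z"
  using triangle[of x z y] assms by (simp add: perimeter_def commute)

text \<open>Any two points of \<open>S\<close> can be completed to a triple by a third one, whatever
  coincidences occur in \<open>S\<close>. This covers cases such as \<open>T x = y\<close> below
  without a case split.\<close>

lemma (in Metric_space) twice_dist_le_Max_perimeters_on:
  assumes S: "finite S" "S \<subseteq> M"
    and xyz: "x \<in> S" "y \<in> S" "z \<in> S" "x \<noteq> y" "y \<noteq> z" "z \<noteq> x"
    and ab: "a \<in> S" "b \<in> S"
  shows "2 * d a b \<le> Max (perimeters_on d S)"
proof -
  \<comment> \<open>At most two of the distinct \<open>x\<close>, \<open>y\<close>, \<open>z\<close>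
    lie in \<open>{a, b}\<close>.\<close>
  have "\<exists>c\<in>S. a \<noteq> c \<and> b \<noteq> c" using xyz by metis
  then obtain c where c: "c \<in> S" "a \<noteq> c" "b \<noteq> c" by blast
  have Max: "p \<in> perimeters_on d S \<Longrightarrow> p \<le> Max (perimeters_on d S)" for p
    using finite_perimeters_on[OF S(1)] by simp
  show ?thesis
  proof (cases "a = b")
    case True
    have "perimeter d x y z \<in> perimeters_on d S"
      using xyz unfolding perimeters_on_def by blast
    moreover have "perimeter d x y z \<ge> 0" by (simp add: perimeter_def)
    ultimately show ?thesis using True Max S ab by fastforce
  next
    case False
    then have "perimeter d a b c \<in> perimeters_on d S"
      using ab c unfolding perimeters_on_def by blast
    moreover have "2 * d a b \<le> perimeter d a b c"
      using ab c S(2) by (intro twice_dist_le_perimeter) auto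
    ultimately show ?thesis using Max by fastforce
  qed
qed

theorem theorem3p1:
  fixes X :: "'a set" and d :: "'a \<Rightarrow> 'a \<Rightarrow> real"
  assumes "Metric_space X d"
    and "infinite X \<or> card X \<ge> 3"
    and "\<And>T. T \<in> X \<rightarrow> X \<Longrightarrow> no_two_cycles X T \<Longrightarrow> perimeter_quasi_contraction X d T
            \<Longrightarrow> \<exists>x\<in>X. T x = x"
  shows "Metric_space.mcomplete X d"
proof (rule ccontr)
  interpret Metric_space X d by fact
  assume "\<not> mcomplete"
  then obtain L :: "'a \<Rightarrow> real" where
    pos: "\<And>x. x \<in> X \<Longrightarrow> 0 < L x" and
    sum: "\<And>x y. x \<in> X \<Longrightarrow> y \<in> X \<Longrightarrow> d x y \<le> L x + L y" and
    diff: "\<And>x y. x \<in> X \<Longrightarrow> y \<in> X \<Longrightarrow> L x \<le> d x y + L y" and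
    small: "\<And>e. 0 < e \<Longrightarrow> \<exists>x\<in>X. L x \<le> e"
    by (rule not_mcomplete_ideal_dist) blast
  \<comment> \<open>With ratio \<open>q\<close> in place of 1/5, the estimates below give
    \<open>k = 3 * q / (1 - q)\<close>, which is less than 1 for \<open>0 < q < 1/4\<close>.\<close>
  have "\<forall>x\<in>X. \<exists>y\<in>X. L y \<le> L x / 5"
    using pos small by (meson divide_pos_pos zero_less_numeral)
  then obtain T where T: "\<And>x. x \<in> X \<Longrightarrow> T x \<in> X" "\<And>x. x \<in> X \<Longrightarrow> L (T x) \<le> L x / 5"
    by metis
  have less: "L (T x) < L x" if "x \<in> X" for x
    using T(2)[OF that] pos[OF that] by linarith
  have "no_two_cycles X T"
    unfolding no_two_cycles_def using less T(1) by (metis comp_apply less_asym)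
  moreover have "perimeter_quasi_contraction X d T"
    unfolding perimeter_quasi_contraction_def
  proof (intro exI[of _ "3/4"] conjI ballI impI)
    fix x y z assume X: "x \<in> X" "y \<in> X" "z \<in> X" and dist: "x \<noteq> y \<and> y \<noteq> z \<and> z \<noteq> x"
    let ?S = "{x, y, z, T x, T y, T z}"
    have bound: "8/5 * L w \<le> Max (perimeters_on d ?S)" if w: "w \<in> {x, y, z}" for w
    proof -
      have "2 * d w (T w) \<le> Max (perimeters_on d ?S)"
        using X T(1) w dist by (intro twice_dist_le_Max_perimeters_on[of ?S x y z]) auto
      moreover have "w \<in> X" using w X by auto
      \<comment> \<open>\<open>d w (T w) \<ge> L w - L (T w) \<ge> 4/5 * L w\<close>.\<close>
      ultimately show ?thesis using diff[of w "T w"] T[of w] by linarith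
    qed
    have "perimeter d (T x) (T y) (T z) \<le> 2 * (L (T x) + L (T y) + L (T z))"
      using sum[of "T x" "T y"] sum[of "T y" "T z"] sum[of "T z" "T x"] T(1) X
      by (simp add: perimeter_def)
    also have "\<dots> \<le> 2/5 * (L x + L y + L z)"
      using T(2)[of x] T(2)[of y] T(2)[of z] X by simp
    \<comment> \<open>Each of the three values of \<open>L\<close> is at most 5/8 of the maximum,
      and \<open>2/5 * 3 * 5/8 = 3/4\<close>.\<close>
    also have "\<dots> \<le> 3/4 * Max (perimeters_on d ?S)"
      using bound[of x] bound[of y] bound[of z] by simp
    finally show "perimeter d (T x) (T y) (T z) \<le> 3/4 * Max (perimeters_on d ?S)" .
  qed simp_all
  ultimately obtain x where "x \<in> X" "T x = x"
    using assms(3)[of T] T(1) by blast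
  then show False using less by fastforce
qed

end
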